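(* Let $0<\rho<1$ and let $\mu$ be a probability distribution on $\mathbf{R}$. Then $\mu$ is the marginal distribution of a marginally stationary AR(1) sequence with coefficient $\rho$ if and only if $\mu$ is semi-selfdecomposable($\rho$). Explicitly: there exist random variables $\{X_n\}$ and i.i.d. random variables $\{\varepsilon_n\}$, with $\varepsilon_n$ independent of $X_{n-1}$, such that $X_n=\rho X_{n-1}+\varepsilon_n$ for all $n$ and every $X_n$ has distribution $\mu$, if and only if the characteristic function $f$ of $\mu$ satisfies $f(s)=f(\rho s)f_o(s)$ for all $s\in\mathbf{R}$, for some characteristic function $f_o$.
   Context: A linear additive first order autoregressive (AR(1)) sequence with coefficient $\rho\in(0,1)$ is a sequence of real random variables $\{X_n\}$ satisfying $X_n=\rho X_{n-1}+\varepsilon_n$, where the innovations $\{\varepsilon_n\}$ are i.i.d. and $\varepsilon_n$ is independent of $X_{n-1}$. It is marginally stationary if all $X_n$ have the same distribution; in terms of characteristic functions this reads $f_X(s)=f_X(\rho s)f_\varepsilon(s)$. For $b\in(0,1)$, a probability distribution on $\mathbf{R}$ with characteristic function $f$ is semi-selfdecomposable($b$), written semi-SD($b$), if there exists a characteristic function $f_o$ such that $f(s)=f(bs)f_o(s)$ for all $s\in\mathbf{R}$. *)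

theory Defs
  imports "HOL-Probability.Probability"
begin

definition char_function :: "(real \<Rightarrow> complex) \<Rightarrow> bool" where
  "char_function f \<longleftrightarrow> (\<exists>\<nu>. real_distribution \<nu> \<and> f = char \<nu>)"

definition semi_selfdecomposable :: "real \<Rightarrow> real measure \<Rightarrow> bool" where
  "semi_selfdecomposable b \<mu> \<longleftrightarrow> real_distribution \<mu> \<and>
     (\<exists>f\<^sub>o. char_function f\<^sub>o \<and> (\<forall>s. char \<mu> s = char \<mu> (b * s) * f\<^sub>o s))"

(* The sequence starts at X 0; the innovations are eps n for n >= 1, and eps 0 is unconstrained.
   Equality of random variables is almost sure equality. *)
definition ar1_sequence ::
    "'a measure \<Rightarrow> real \<Rightarrow> (nat \<Rightarrow> 'a \<Rightarrow> real) \<Rightarrow> (nat \<Rightarrow> 'a \<Rightarrow> real) \<Rightarrow> bool" where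
  "ar1_sequence M \<rho> X \<epsilon> \<longleftrightarrow> prob_space M \<and>
     (\<forall>n. X n \<in> borel_measurable M) \<and>
     prob_space.indep_vars M (\<lambda>_. borel) \<epsilon> {1..} \<and>
     (\<forall>m\<ge>1. \<forall>n\<ge>1. distr M borel (\<epsilon> m) = distr M borel (\<epsilon> n)) \<and>
     (\<forall>n\<ge>1. prob_space.indep_var M borel (X (n - 1)) borel (\<epsilon> n)) \<and>
     (\<forall>n\<ge>1. AE \<omega> in M. X n \<omega> = \<rho> * X (n - 1) \<omega> + \<epsilon> n \<omega>)"

(* Marginal stationarity is part of this: all X n have the same law, namely mu. *)
definition stationary_ar1_with_marginal ::
    "'a measure \<Rightarrow> real \<Rightarrow> (nat \<Rightarrow> 'a \<Rightarrow> real) \<Rightarrow> (nat \<Rightarrow> 'a \<Rightarrow> real) \<Rightarrow> real measure \<Rightarrow> bool" where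
  "stationary_ar1_with_marginal M \<rho> X \<epsilon> \<mu> \<longleftrightarrow>
     ar1_sequence M \<rho> X \<epsilon> \<and> (\<forall>n. distr M borel (X n) = \<mu>)"

(* HOL cannot quantify over the type of the sample space, so a theorem about the existence of such
   sequences has to fix one in the existential claim. The type nat => real of real sequences is
   rich enough to carry (X 0, eps 1, eps 2, ...). Necessity can be claimed for a sample space of
   any type. *)

end

theory Submission
  imports Defs
begin

text \<open>Independence turns \<open>X\<^sub>n = \<rho> X\<^sub>n\<^sub>-\<^sub>1 + \<epsilon>\<^sub>n\<close> into the factorization
  \<open>f\<^sub>X\<^sub>n(s) = f\<^sub>X\<^sub>n\<^sub>-\<^sub>1(\<rho> s) f\<^sub>\<epsilon>(s)\<close>, so stationarity yields semi-selfdecomposability with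
  \<open>f\<^sub>o = f\<^sub>\<epsilon>\<close>. Conversely, let \<open>f\<^sub>o\<close> be the characteristic function of \<open>\<nu>\<close> and run the recursion
  on the product space \<open>\<mu> \<otimes> \<nu> \<otimes> \<nu> \<otimes> \<dots>\<close>: since \<open>X\<^sub>n\<close> depends only on the coordinates up to \<open>n\<close>,
  it is independent of \<open>\<epsilon>\<^sub>n\<^sub>+\<^sub>1\<close>, and the law \<open>\<mu>\<close> propagates by induction and Levy's uniqueness
  theorem.\<close>

text \<open>Both directions use this factorization: necessity reads \<open>f\<^sub>o\<close> off it,
  sufficiency uses it to carry the law one step forward.\<close>

lemma (in prob_space) char_distr_scale_add:
  fixes X E :: "'a \<Rightarrow> real"
  assumes "indep_var borel X borel E"
  shows "char (distr M borel (\<lambda>\<omega>. r * X \<omega> + E \<omega>)) s =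
    char (distr M borel X) (r * s) * char (distr M borel E) s"
proof -
  have [measurable]: "random_variable borel X"
    using assms by (rule indep_var_rv1)
  have "indep_var borel ((\<lambda>x. r * x) \<circ> X) borel ((\<lambda>x. x) \<circ> E)"
    using assms by (rule indep_var_compose) auto
  then have "indep_var borel (\<lambda>\<omega>. r * X \<omega>) borel E"
    by (simp add: comp_def)
  moreover have "char (distr M borel (\<lambda>\<omega>. r * X \<omega>)) s = char (distr M borel X) (r * s)"
    by (simp add: char_def integral_distr mult_ac)
  ultimately show ?thesis
    by (simp add: char_distr_add)
qed

lemma stationary_ar1_imp_semi_selfdecomposable:
  assumes "stationary_ar1_with_marginal M \<rho> X \<epsilon> \<mu>"
  shows "semi_selfdecomposable \<rho> \<mu>"
proof -
  have ps: "prob_space M"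
    using assms by (simp add: stationary_ar1_with_marginal_def ar1_sequence_def)
  interpret prob_space M by (rule ps)
  have X [measurable]: "\<And>n. random_variable borel (X n)"
    and law: "\<And>n. distr M borel (X n) = \<mu>"
    and ind: "\<And>n. n \<ge> 1 \<Longrightarrow> indep_var borel (X (n - 1)) borel (\<epsilon> n)"
    and step: "\<And>n. n \<ge> 1 \<Longrightarrow> AE \<omega> in M. X n \<omega> = \<rho> * X (n - 1) \<omega> + \<epsilon> n \<omega>"
    using assms by (auto simp: stationary_ar1_with_marginal_def ar1_sequence_def)
  \<comment> \<open>The single transition from \<open>X 0\<close> to \<open>X 1\<close> suffices, as
    both ends have law \<mu>; the recursion holds only almost surely, but laws ignore null
    sets.\<close>
  have ind1: "indep_var borel (X 0) borel (\<epsilon> 1)"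
    using ind[of 1] by simp
  have E: "random_variable borel (\<epsilon> 1)"
    using ind1 by (rule indep_var_rv2)
  then have "\<mu> = distr M borel (\<lambda>\<omega>. \<rho> * X 0 \<omega> + \<epsilon> 1 \<omega>)"
    unfolding law[of 1, symmetric] using step[of 1] by (intro distr_cong_AE) auto
  then have "char \<mu> s = char \<mu> (\<rho> * s) * char (distr M borel (\<epsilon> 1)) s" for s
    using char_distr_scale_add[OF ind1, of \<rho> s] law[of 0] by simp
  moreover have "real_distribution \<mu>"
    unfolding law[of 0, symmetric] by simp
  ultimately show ?thesis
    unfolding semi_selfdecomposable_def char_function_def
    using real_distribution_distr[OF E] by blast
qed

text \<open>A pushforward depends on its target only through the sigma-algebra, so
  \<open>borel\<close> can replace \<open>N i\<close>.\<close>

lemma distr_PiM_component_borel: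
  assumes "\<And>i. prob_space (N i)" and "\<And>i. sets (N i) = sets borel"
  shows "distr (PiM UNIV N) borel (\<lambda>\<omega>. \<omega> i) = N i"
proof -
  have "distr (PiM UNIV N) borel (\<lambda>\<omega>. \<omega> i) = distr (PiM UNIV N) (N i) (\<lambda>\<omega>. \<omega> i)"
    using assms(2) by (intro distr_cong) auto
  also have "\<dots> = N i"
    using assms(1) by (intro distr_PiM_component) auto
  finally show ?thesis .
qed

lemma indep_vars_PiM_component_borel:
  assumes N: "\<And>i. prob_space (N i)" "\<And>i. sets (N i) = sets borel"
  shows "prob_space.indep_vars (PiM UNIV N) (\<lambda>_. borel) (\<lambda>i \<omega>. \<omega> i) UNIV"
proof -
  interpret P: prob_space "PiM UNIV N"
    using N(1) by (intro prob_space_PiM)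
  have sets_PiM_N: "sets (PiM UNIV N) = sets (PiM UNIV (\<lambda>_. borel))"
    using N(2) by (intro sets_PiM_cong) auto
  have rv: "(\<lambda>\<omega>. \<omega> i) \<in> borel_measurable (PiM UNIV N)" for i
    using measurable_component_singleton[of i UNIV N]
    by (subst measurable_cong_sets[OF refl N(2)[of i, symmetric]]) simp
  \<comment> \<open>Jointly the coordinates form the identity map, so their joint law is the product
    of their marginals, which is the criterion for independence.\<close>
  have "distr (PiM UNIV N) (PiM UNIV (\<lambda>_. borel)) (\<lambda>\<omega>. \<omega>) = PiM UNIV N"
    using sets_PiM_N by (intro distr_id2) auto
  then show ?thesis
    using rv by (subst P.indep_vars_iff_distr_eq_PiM)
      (auto simp: distr_PiM_component_borel[OF N] restrict_def)
qed

primrec ar1_path :: "real \<Rightarrow> nat \<Rightarrow> (nat \<Rightarrow> real) \<Rightarrow> real" where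
  "ar1_path \<rho> 0 = (\<lambda>\<omega>. \<omega> 0)"
| "ar1_path \<rho> (Suc n) = (\<lambda>\<omega>. \<rho> * ar1_path \<rho> n \<omega> + \<omega> (Suc n))"

lemma ar1_path_restrict: "n \<in> A \<Longrightarrow> {..n} \<subseteq> A \<Longrightarrow> ar1_path \<rho> n (restrict \<omega> A) = ar1_path \<rho> n \<omega>"
  by (induction n) (auto simp: atMost_Suc)

text \<open>The index set is kept general for two uses: \<open>UNIV\<close> makes the path a random
  variable on the whole product, \<open>{..n}\<close> makes it a function of the first coordinates
  alone.\<close>

lemma measurable_ar1_path:
  "{..n} \<subseteq> A \<Longrightarrow> ar1_path \<rho> n \<in> borel_measurable (PiM A (\<lambda>_. borel))"
proof (induction n)
  case (Suc n)
  then have "ar1_path \<rho> n \<in> borel_measurable (PiM A (\<lambda>_. borel))" "Suc n \<in> A"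
    by (auto simp: atMost_Suc)
  then show ?case
    by (simp add: measurable_component_singleton)
qed (simp add: measurable_component_singleton)

lemma semi_selfdecomposable_imp_stationary_ar1:
  assumes "semi_selfdecomposable \<rho> \<mu>"
  shows "\<exists>(M :: (nat \<Rightarrow> real) measure) X \<epsilon>. stationary_ar1_with_marginal M \<rho> X \<epsilon> \<mu>"
proof -
  from assms obtain \<nu> where \<mu>: "real_distribution \<mu>" and \<nu>: "real_distribution \<nu>"
    and char_\<mu>: "\<And>s. char \<mu> s = char \<mu> (\<rho> * s) * char \<nu> s"
    by (auto simp: semi_selfdecomposable_def char_function_def)
  \<comment> \<open>Coordinate 0 carries the initial value, the later ones the innovations. As
    innovations are constrained only from index 1 on, coordinate 0 can serve as both
    \<open>X 0\<close> and \<open>\<epsilon> 0\<close>.\<close>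
  define N where "N i = (if i = 0 then \<mu> else \<nu>)" for i :: nat
  have N: "prob_space (N i)" "sets (N i) = sets borel" for i
    using \<mu> \<nu> by (auto simp: N_def real_distribution_def real_distribution_axioms_def)
  let ?P = "PiM UNIV N"
  interpret P: prob_space ?P
    using N(1) by (intro prob_space_PiM)
  have ind: "P.indep_vars (\<lambda>_. borel) (\<lambda>i \<omega>. \<omega> i) UNIV"
    using N by (rule indep_vars_PiM_component_borel)
  have "sets ?P = sets (PiM UNIV (\<lambda>_. borel))"
    using N(2) by (intro sets_PiM_cong) auto
  then have X: "ar1_path \<rho> n \<in> borel_measurable ?P" for n
    using measurable_ar1_path[of n UNIV \<rho>] measurable_cong_sets[OF _ refl] by blast
  have indX: "P.indep_var borel (ar1_path \<rho> n) borel (\<lambda>\<omega>. \<omega> (Suc n))" for n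
  proof -
    \<comment> \<open>The disjoint blocks \<open>{..n}\<close> and \<open>{Suc n}\<close> of
      independent coordinates are independent, hence so are measurable functions of them.\<close>
    have "P.indep_var borel (ar1_path \<rho> n \<circ> (\<lambda>\<omega>. restrict (\<lambda>i. \<omega> i) {..n}))
      borel ((\<lambda>\<omega>. \<omega> (Suc n)) \<circ> (\<lambda>\<omega>. restrict (\<lambda>i. \<omega> i) {Suc n}))"
      by (rule P.indep_var_compose[OF P.indep_var_restrict[OF ind]])
        (auto intro: measurable_ar1_path)
    then show ?thesis
      by (simp add: comp_def ar1_path_restrict)
  qed
  have law: "distr ?P borel (ar1_path \<rho> n) = \<mu>" for n
  proof (induction n)
    case 0
    then show ?case
      using distr_PiM_component_borel[of N, OF N, of 0] by (simp add: N_def[of 0])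
  next
    case (Suc n)
    \<comment> \<open>By the induction hypothesis the factorization gives the right-hand side of
      \<open>char_\<mu>\<close>, which folds back to \<open>char \<mu> s\<close>.\<close>
    have "char (distr ?P borel (ar1_path \<rho> (Suc n))) s = char \<mu> s" for s
      using P.char_distr_scale_add[OF indX, of \<rho> n s] Suc char_\<mu>[of s]
        distr_PiM_component_borel[of N, OF N, of "Suc n"] by (simp add: N_def[of "Suc n"])
    then show ?case
      using \<mu> P.real_distribution_distr[OF X] by (intro Levy_uniqueness ext)
  qed
  have "ar1_sequence ?P \<rho> (ar1_path \<rho>) (\<lambda>i \<omega>. \<omega> i)"
    unfolding ar1_sequence_def
  proof (intro conjI allI impI)
    show "P.indep_vars (\<lambda>_. borel) (\<lambda>i \<omega>. \<omega> i) {1..}"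
      using ind by (rule P.indep_vars_subset) simp
  next
    fix m n :: nat
    assume "1 \<le> m" "1 \<le> n"
    then show "distr ?P borel (\<lambda>\<omega>. \<omega> m) = distr ?P borel (\<lambda>\<omega>. \<omega> n)"
      using N by (simp add: distr_PiM_component_borel) (simp add: N_def)
  next
    fix n :: nat
    assume "1 \<le> n"
    then obtain k where k: "n = Suc k"
      by (cases n) auto
    show "P.indep_var borel (ar1_path \<rho> (n - 1)) borel (\<lambda>\<omega>. \<omega> n)"
      using indX[of k] by (simp add: k)
    show "AE \<omega> in ?P. ar1_path \<rho> n \<omega> = \<rho> * ar1_path \<rho> (n - 1) \<omega> + \<omega> n"
      by (simp add: k)
  qed (use X P.prob_space_axioms in auto)
  with law show ?thesis
    unfolding stationary_ar1_with_marginal_def by blast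
qed

theorem mainTheorem1:
  fixes \<rho> :: real and \<mu> :: "real measure"
  assumes "0 < \<rho>" and "\<rho> < 1" and "real_distribution \<mu>"
  shows "((\<exists>(M :: (nat \<Rightarrow> real) measure) X \<epsilon>. stationary_ar1_with_marginal M \<rho> X \<epsilon> \<mu>)
            \<longleftrightarrow> semi_selfdecomposable \<rho> \<mu>) \<and>
         (\<forall>(M :: 'a measure) X \<epsilon>. stationary_ar1_with_marginal M \<rho> X \<epsilon> \<mu>
            \<longrightarrow> semi_selfdecomposable \<rho> \<mu>)"
  by (intro conjI iffI allI impI)
    (blast intro: stationary_ar1_imp_semi_selfdecomposable
      semi_selfdecomposable_imp_stationary_ar1)+

end
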